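(* Let $\gamma=\mathrm{diag}(\alpha,\alpha^{-1})$ with $\alpha\in F^\times$, $\alpha\ne\pm1$. If $\alpha\notin\mathcal O^\times$, then $S(\gamma)^{-1}$ is not $\varepsilon$-conjugate to any element of $C$.
   Context: $F$ is a $p$-adic field of characteristic zero, $\mathcal O$ its ring of integers, $\mathfrak p$ its maximal ideal, $\varpi$ a uniformizer. $G=GL_2(F)$, $w=\begin{pmatrix}0&1\\1&0\end{pmatrix}$, $g^{\vdash}=w\,{}^tg\,w$. Elements $X,Y\in G$ are $\varepsilon$-conjugate if $Y=gXg^{\vdash}$ for some $g\in G$. $S(\gamma)=\gamma-I=\mathrm{diag}(\alpha-1,\alpha^{-1}-1)$. Let $E=F(\sqrt\varpi)$, embedded in $M_2(F)$ with $\varpi_E=\sqrt\varpi=\begin{pmatrix}0&1\\\varpi&0\end{pmatrix}$. Let $\mathcal L$ be a compact open subgroup of $G$ contained in $I_1=\begin{pmatrix}1+\mathfrak p&\mathcal O\\\mathfrak p&1+\mathfrak p\end{pmatrix}$ such that $G'=E^\times\mathcal L$ is a subgroup (the inducing subgroup in Kutzko's construction of a supercuspidal representation of $G$ by compact induction of a character of $G'$). Put $C_0=\mathcal O_E^\times\mathcal L$ and $C=C_0\cup\varpi_EC_0$; $C$ is the support of the function $f_G$ obtained by restricting to $C$ the extension by zero of that character. *)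

theory Defs
  imports "HOL-Analysis.Analysis" "HOL-Algebra.Coset"
begin

text \<open>
  A \<open>p\<close>-adic field of characteristic zero: a field of characteristic zero that is complete for a
  nontrivial discrete non-archimedean absolute value with finite residue field. The metric of the
  type is the one of the absolute value, so that \<^typ>\<open>'a^2^2\<close> carries the usual topology of
  \<open>M\<^sub>2(F)\<close>. That \<open>vabs\<close> is nonnegative, vanishes only at \<open>0\<close> and sends \<open>1\<close> to \<open>1\<close> follows from
  the metric axioms and multiplicativity.
\<close>

class padic_field = field_char_0 + complete_space +
  fixes vabs :: "'a \<Rightarrow> real"
  assumes dist_vabs: "dist x y = vabs (x - y)"
    and vabs_mult: "vabs (x * y) = vabs x * vabs y"
    and vabs_ultrametric: "vabs (x + y) \<le> max (vabs x) (vabs y)"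
    and vabs_discrete:
      "\<exists>\<pi>. \<pi> \<noteq> 0 \<and> {x. vabs x < 1} = {\<pi> * y | y. vabs y \<le> 1}"
    and finite_residue_field:
      "finite ({x. vabs x \<le> 1} //
         {(x, y). vabs x \<le> 1 \<and> vabs y \<le> 1 \<and> vabs (x - y) < 1})"

definition integer_ring :: "'a::padic_field set" where
  "integer_ring = {x. vabs x \<le> 1}"

definition integer_units :: "'a::padic_field set" where
  "integer_units = {x \<in> integer_ring. \<exists>y\<in>integer_ring. x * y = 1}"

definition max_ideal :: "'a::padic_field set" where
  "max_ideal = {x. vabs x < 1}"

definition uniformizer :: "'a::padic_field \<Rightarrow> bool" where
  "uniformizer \<pi> \<longleftrightarrow> max_ideal = {\<pi> * y | y. y \<in> integer_ring}"

definition mat2 :: "'a \<Rightarrow> 'a \<Rightarrow> 'a \<Rightarrow> 'a \<Rightarrow> 'a::zero^2^2" where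
  "mat2 a b c d = vector [vector [a, b], vector [c, d]]"

definition GL2 :: "('a::padic_field^2^2) monoid" where
  "GL2 = \<lparr>carrier = {g. invertible g}, mult = (**), one = mat 1\<rparr>"

definition w_mat :: "'a::padic_field^2^2" where
  "w_mat = mat2 0 1 1 0"

definition vdash :: "'a::padic_field^2^2 \<Rightarrow> 'a^2^2" where
  "vdash g = w_mat ** transpose g ** w_mat"

definition eps_conjugate :: "'a::padic_field^2^2 \<Rightarrow> 'a^2^2 \<Rightarrow> bool" where
  "eps_conjugate X Y \<longleftrightarrow> (\<exists>g\<in>carrier GL2. Y = g ** X ** vdash g)"

definition S_map :: "'a::padic_field^2^2 \<Rightarrow> 'a^2^2" where
  "S_map g = g - mat 1"

definition I1 :: "('a::padic_field^2^2) set" where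
  "I1 = {mat2 (1 + a) b c (1 + d) | a b c d.
           a \<in> max_ideal \<and> b \<in> integer_ring \<and> c \<in> max_ideal \<and> d \<in> max_ideal}"

definition pi_E :: "'a::padic_field \<Rightarrow> 'a^2^2" where
  "pi_E \<pi> = mat2 0 1 \<pi> 0"

text \<open>
  \<open>E = F(\<surd>\<pi>)\<close> inside \<open>M\<^sub>2(F)\<close>: the matrices \<open>a + b \<surd>\<pi>\<close>, where \<open>\<surd>\<pi>\<close> stands for
  \<^term>\<open>pi_E \<pi>\<close>.
\<close>

definition E_field :: "'a::padic_field \<Rightarrow> ('a^2^2) set" where
  "E_field \<pi> = {mat a + mat b ** pi_E \<pi> | a b. True}"

text \<open>
  The absolute value of \<open>F\<close> extends to \<open>E\<close> as \<open>\<bar>N(x)\<bar>\<close> to the power \<open>1/[E:F]\<close>, and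
  the norm \<open>N\<close> from \<open>E\<close> to \<open>F\<close> is the restriction of the determinant.
\<close>

definition E_abs :: "'a::padic_field^2^2 \<Rightarrow> real" where
  "E_abs x = sqrt (vabs (det x))"

definition E_integers :: "'a::padic_field \<Rightarrow> ('a^2^2) set" where
  "E_integers \<pi> = {x \<in> E_field \<pi>. E_abs x \<le> 1}"

definition E_integer_units :: "'a::padic_field \<Rightarrow> ('a^2^2) set" where
  "E_integer_units \<pi> = {x \<in> E_integers \<pi>. \<exists>y\<in>E_integers \<pi>. x ** y = mat 1}"

definition G_prime :: "'a::padic_field \<Rightarrow> ('a^2^2) set \<Rightarrow> ('a^2^2) set" where
  "G_prime \<pi> L = (E_field \<pi> - {0}) <#>\<^bsub>GL2\<^esub> L"

definition C0 :: "'a::padic_field \<Rightarrow> ('a^2^2) set \<Rightarrow> ('a^2^2) set" where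
  "C0 \<pi> L = E_integer_units \<pi> <#>\<^bsub>GL2\<^esub> L"

definition C_set :: "'a::padic_field \<Rightarrow> ('a^2^2) set \<Rightarrow> ('a^2^2) set" where
  "C_set \<pi> L = C0 \<pi> L \<union> (pi_E \<pi> <#\<^bsub>GL2\<^esub> C0 \<pi> L)"

end

theory Submission
  imports Defs
begin

text \<open>
  \<open>\<epsilon>\<close>-conjugation of \<open>Y\<close> is congruence of the bilinear form \<open>B = Y w\<close>, so it preserves the
  trace \<open>(a\<^sup>2 + d\<^sup>2 - 2 b c) / (a d - b c)\<close> of the asymmetry \<open>B\<^sup>-\<^sup>T B\<close>. For \<open>S(\<gamma>)\<inverse>\<close> this trace
  is \<open>- (\<alpha> + \<alpha>\<inverse>)\<close>, which is not integral unless \<open>\<alpha>\<close> is a unit. On \<open>C\<^sub>0\<close>, which lies in the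
  Iwahori subgroup, the numerator is integral and the denominator is a unit; on \<open>\<surd>\<pi> C\<^sub>0\<close> the
  numerator is divisible by \<open>\<pi>\<close> and the denominator is \<open>\<pi>\<close> times a unit. So the trace is integral
  on all of \<open>C\<close>.
\<close>

section \<open>The absolute value and uniformizers\<close>

lemma vabs_0 [simp]: "vabs (0::'a::padic_field) = 0"
  using dist_vabs[of "0::'a" 0] by simp

lemma vabs_nonneg [simp]: "0 \<le> vabs (x::'a::padic_field)"
  using dist_vabs[of x 0] by (metis diff_zero zero_le_dist)

lemma vabs_eq_0_iff [simp]: "vabs (x::'a::padic_field) = 0 \<longleftrightarrow> x = 0"
  using dist_vabs[of x 0] by (metis diff_zero dist_eq_0_iff)

lemma vabs_1 [simp]: "vabs (1::'a::padic_field) = 1"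
  using vabs_mult[of "1::'a" 1] vabs_eq_0_iff[of "1::'a"] by simp

lemma vabs_minus [simp]: "vabs (- x) = vabs (x::'a::padic_field)"
  using dist_vabs[of 0 x] dist_vabs[of x 0] by (simp add: dist_commute)

lemma vabs_power: "vabs (x ^ n) = vabs (x::'a::padic_field) ^ n"
  by (induction n) (auto simp: vabs_mult)

lemma vabs_inverse: "vabs (inverse x) = inverse (vabs (x::'a::padic_field))"
proof (cases "x = 0")
  case False
  then have "vabs x * vabs (inverse x) = 1"
    by (simp flip: vabs_mult)
  then show ?thesis
    by (metis inverse_unique)
qed simp

lemma vabs_add_le:
  "vabs x \<le> r \<Longrightarrow> vabs y \<le> r \<Longrightarrow> vabs (x + y :: 'a::padic_field) \<le> r"
  using vabs_ultrametric[of x y] by simp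

lemma vabs_diff_le:
  "vabs x \<le> r \<Longrightarrow> vabs y \<le> r \<Longrightarrow> vabs (x - y :: 'a::padic_field) \<le> r"
  using vabs_add_le[of x r "- y"] by simp

text \<open>Asymmetric on purpose: with \<open>r = 1\<close> it gives integrality, with
  \<open>r = vabs \<pi>\<close> divisibility by \<pi>.\<close>

lemma vabs_mult_le:
  "vabs x \<le> r \<Longrightarrow> vabs y \<le> 1 \<Longrightarrow> vabs (x * y :: 'a::padic_field) \<le> r"
  using mult_mono[of "vabs x" r "vabs y" 1] order_trans[OF vabs_nonneg[of x]]
  by (auto simp: vabs_mult)

text \<open>The reverse inequality comes from writing \<open>x = (x + y) + (- y)\<close>, where the
  strictly smaller \<open>y\<close> cannot attain the maximum.\<close>

lemma vabs_add_eq_left: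
  assumes "vabs y < vabs (x::'a::padic_field)"
  shows "vabs (x + y) = vabs x"
  using assms vabs_ultrametric[of x y] vabs_ultrametric[of "x + y" "- y"] by simp

lemma vabs_2_le: "vabs (2::'a::padic_field) \<le> 1"
  using vabs_add_le[of "1::'a" 1 1] by simp

lemma integer_units_iff: "x \<in> integer_units \<longleftrightarrow> vabs (x::'a::padic_field) = 1"
proof
  assume "x \<in> integer_units"
  then obtain y where "vabs x \<le> 1" "vabs y \<le> 1" "x * y = 1"
    by (auto simp: integer_units_def integer_ring_def)
  then show "vabs x = 1"
    by (metis mult_left_le order_antisym vabs_1 vabs_mult vabs_nonneg)
next
  assume "vabs x = 1"
  then have "x * inverse x = 1" "vabs (inverse x) \<le> 1"
    by (auto simp: vabs_inverse intro!: right_inverse)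
  with \<open>vabs x = 1\<close> show "x \<in> integer_units"
    by (auto simp: integer_units_def integer_ring_def)
qed

lemma uniformizer_vabs:
  assumes "uniformizer (\<pi>::'a::padic_field)"
  shows "0 < vabs \<pi>" "vabs \<pi> < 1" "\<And>x::'a. vabs x < 1 \<Longrightarrow> vabs x \<le> vabs \<pi>"
proof -
  have int: "vabs x < 1 \<longleftrightarrow> (\<exists>y. x = \<pi> * y \<and> vabs y \<le> 1)" for x
    using assms by (auto simp: uniformizer_def max_ideal_def integer_ring_def set_eq_iff)
  \<comment> \<open>\<open>uniformizer\<close> by itself would admit 0 if the maximal ideal were
    zero; the nonzero generator \<open>p\<close> from the class axiom is a multiple of \<pi> and
    excludes this.\<close>
  obtain p :: 'a where "p \<noteq> 0" and "{x. vabs x < 1} = {p * y | y. vabs y \<le> 1}"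
    using vabs_discrete by blast
  then have "p * 1 \<in> {x. vabs x < 1}"
    by (metis (mono_tags, lifting) mem_Collect_eq order_refl vabs_1)
  then obtain y where "p = \<pi> * y"
    using int[of p] by auto
  with \<open>p \<noteq> 0\<close> show "0 < vabs \<pi>"
    by (simp add: less_le)
  have "\<pi> = \<pi> * 1 \<and> vabs (1::'a) \<le> 1"
    by simp
  then show "vabs \<pi> < 1"
    using int[of \<pi>] by blast
  show "vabs x \<le> vabs \<pi>" if "vabs x < 1" for x :: 'a
  proof -
    obtain y where "x = \<pi> * y" "vabs y \<le> 1"
      using int[of x] \<open>vabs x < 1\<close> by blast
    then show ?thesis
      using vabs_mult_le[of \<pi> "vabs \<pi>" y] by simp
  qed
qed

text \<open>
  Since \<open>\<bar>\<pi>\<bar>\<close> is not the square of a value, no cancellation occurs in the norm \<open>a\<^sup>2 - b\<^sup>2 \<pi>\<close>.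
\<close>

lemma uniformizer_norm_integral:
  assumes \<pi>: "uniformizer (\<pi>::'a::padic_field)"
    and norm: "vabs (a\<^sup>2 - b\<^sup>2 * \<pi>) \<le> 1"
  shows "vabs a \<le> 1" "vabs b \<le> 1"
proof -
  note p = uniformizer_vabs[OF \<pi>]
  have b_le: "vabs b \<le> 1" if "(vabs b)\<^sup>2 * vabs \<pi> \<le> 1"
  proof (rule ccontr)
    assume "\<not> ?thesis"
    then have "1 < vabs b" by simp
    \<comment> \<open>Discreteness: no value lies strictly between \<open>vabs \<pi>\<close> and
      1.\<close>
    then have "inverse (vabs b) \<le> vabs \<pi>"
      using p(3)[of "inverse b"] by (simp add: vabs_inverse inverse_less_1_iff)
    with \<open>1 < vabs b\<close> have "1 \<le> vabs \<pi> * vabs b"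
      by (simp add: field_simps)
    with \<open>1 < vabs b\<close> have "1 * 1 < vabs b * (vabs \<pi> * vabs b)"
      by (intro mult_less_le_imp_less) auto
    with that show False
      by (simp add: power2_eq_square mult_ac)
  qed
  have a_le: "vabs a \<le> 1" if "(vabs a)\<^sup>2 \<le> 1"
    using that by (simp add: power_le_one_iff abs_square_le_1)
  consider "(vabs b)\<^sup>2 * vabs \<pi> < (vabs a)\<^sup>2" | "(vabs a)\<^sup>2 < (vabs b)\<^sup>2 * vabs \<pi>"
    | "(vabs a)\<^sup>2 = (vabs b)\<^sup>2 * vabs \<pi>"
    by linarith
  then have "(vabs a)\<^sup>2 \<le> 1 \<and> (vabs b)\<^sup>2 * vabs \<pi> \<le> 1"
  proof cases
    case 1
    then have "vabs (a\<^sup>2 - b\<^sup>2 * \<pi>) = (vabs a)\<^sup>2"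
      using vabs_add_eq_left[of "- (b\<^sup>2 * \<pi>)" "a\<^sup>2"] by (simp add: vabs_mult vabs_power)
    with 1 norm show ?thesis by simp
  next
    case 2
    then have "vabs (a\<^sup>2 - b\<^sup>2 * \<pi>) = (vabs b)\<^sup>2 * vabs \<pi>"
      using vabs_add_eq_left[of "a\<^sup>2" "- (b\<^sup>2 * \<pi>)"] by (simp add: vabs_mult vabs_power)
    with 2 norm show ?thesis by simp
  next
    case 3
    have "b = 0"
    proof (rule ccontr)
      assume "b \<noteq> 0"
      \<comment> \<open>\<open>t\<close> is the value of a/b and a square root of
        \<open>vabs \<pi>\<close>. Then t < 1, so discreteness gives t \<le> t * t, which is absurd
        for 0 < t < 1.\<close>
      define t where "t = vabs a / vabs b"
      have t_vabs: "t = vabs (a * inverse b)"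
        unfolding vabs_mult vabs_inverse by (simp add: t_def field_simps)
      have t: "t\<^sup>2 = vabs \<pi>"
        using 3 \<open>b \<noteq> 0\<close>
        by (simp add: t_def power_divide)
      have "0 \<le> t" by (simp add: t_def)
      have "t < 1"
        using t p(2) \<open>0 \<le> t\<close> by (metis abs_of_nonneg abs_square_less_1)
      then have "t \<le> vabs \<pi>"
        using p(3)[of "a * inverse b"] unfolding t_vabs by blast
      have "0 < t" using t p(1) \<open>0 \<le> t\<close> by (cases "t = 0") auto
      then have "t * t < t * 1" using \<open>t < 1\<close> by (intro mult_strict_left_mono)
      with t \<open>t \<le> vabs \<pi>\<close> show False by (simp add: power2_eq_square)
    qed
    with 3 show ?thesis by simp
  qed
  then show "vabs a \<le> 1" "vabs b \<le> 1"
    using a_le b_le by auto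
qed

section \<open>Two-by-two matrices and the invariant\<close>

lemma mat2_nth [simp]:
  "mat2 a b c d $ 1 $ 1 = a" "mat2 a b c d $ 1 $ 2 = b"
  "mat2 a b c d $ 2 $ 1 = c" "mat2 a b c d $ 2 $ 2 = d"
  by (simp_all add: mat2_def)

lemma matrix_mult_nth_2:
  "((A::'a::semiring_1^2^2) ** B) $ i $ j = A $ i $ 1 * B $ 1 $ j + A $ i $ 2 * B $ 2 $ j"
  by (simp add: matrix_matrix_mult_def sum_2)

lemma vdash_nth [simp]:
  "vdash g $ 1 $ 1 = g $ 2 $ 2" "vdash g $ 1 $ 2 = g $ 1 $ 2"
  "vdash g $ 2 $ 1 = g $ 2 $ 1" "vdash g $ 2 $ 2 = g $ 1 $ 1"
  by (simp_all add: vdash_def w_mat_def matrix_mult_nth_2 transpose_def)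

text \<open>The numerator of the trace of the asymmetry of \<open>Y w\<close>.\<close>

definition asym_form :: "'a::comm_ring_1^2^2 \<Rightarrow> 'a" where
  "asym_form Y = (Y $ 1 $ 1)\<^sup>2 + (Y $ 2 $ 2)\<^sup>2 - 2 * Y $ 1 $ 2 * Y $ 2 $ 1"

text \<open>Congruence of \<open>Y w\<close> conjugates its asymmetry and fixes the trace, so the
  numerator must scale like the determinant. As a polynomial identity this needs no
  invertibility.\<close>

lemma asym_form_eps:
  "asym_form (g ** X ** vdash g) = (det g)\<^sup>2 * asym_form (X::'a::padic_field^2^2)"
  by (simp add: asym_form_def matrix_mult_nth_2 det_2 power2_eq_square algebra_simps)

lemma det_eps: "det (g ** X ** vdash g) = (det g)\<^sup>2 * det (X::'a::padic_field^2^2)"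
  by (simp add: matrix_mult_nth_2 det_2 power2_eq_square algebra_simps)

text \<open>Integrality of that trace, stated without division.\<close>

definition integral_asym :: "'a::padic_field^2^2 \<Rightarrow> bool" where
  "integral_asym Y \<longleftrightarrow> vabs (asym_form Y) \<le> vabs (det Y)"

lemma integral_asym_eps_conjugate:
  assumes "eps_conjugate X Y"
  shows "integral_asym Y \<longleftrightarrow> integral_asym X"
proof -
  obtain g where "invertible g" and Y: "Y = g ** X ** vdash g"
    using assms by (auto simp: eps_conjugate_def GL2_def)
  then have "(vabs (det g))\<^sup>2 > 0"
    by (simp add: invertible_det_nz)
  then show ?thesis
    by (simp only: Y integral_asym_def asym_form_eps det_eps vabs_mult vabs_power
        mult_le_cancel_left_pos)
qed

section \<open>The Iwahori subgroup and integrality on \<open>C_set\<close>\<close>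

definition iwahori :: "('a::padic_field^2^2) set" where
  "iwahori = {Y. (\<forall>i j. vabs (Y $ i $ j) \<le> 1) \<and> vabs (Y $ 2 $ 1) < 1 \<and> vabs (det Y) = 1}"

text \<open>Prescribing a unit determinant instead of unit diagonal entries reduces that condition
  to multiplicativity of \<open>det\<close>.\<close>

lemma iwahori_mult:
  assumes "A \<in> iwahori" "B \<in> iwahori"
  shows "A ** B \<in> iwahori"
proof -
  have "vabs ((A ** B) $ i $ j) \<le> 1" for i j
    using assms by (auto simp: iwahori_def matrix_mult_nth_2 intro!: vabs_add_le vabs_mult_le)
  moreover have "vabs ((A ** B) $ 2 $ 1) < 1"
  proof -
    have "vabs (A $ 2 $ 1 * B $ 1 $ 1) < 1" "vabs (B $ 2 $ 1 * A $ 2 $ 2) < 1"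
      using assms vabs_mult_le[of "A $ 2 $ 1" _ "B $ 1 $ 1", OF order_refl]
        vabs_mult_le[of "B $ 2 $ 1" _ "A $ 2 $ 2", OF order_refl]
      by (auto simp: iwahori_def intro: le_less_trans)
    then show ?thesis
      using vabs_ultrametric[of "A $ 2 $ 1 * B $ 1 $ 1" "A $ 2 $ 2 * B $ 2 $ 1"]
      by (simp add: matrix_mult_nth_2 mult.commute)
  qed
  ultimately show ?thesis
    using assms by (simp add: iwahori_def det_mul vabs_mult)
qed

lemma I1_subset_iwahori: "I1 \<subseteq> iwahori"
proof
  fix Y :: "'a^2^2"
  assume "Y \<in> I1"
  then obtain a b c d where Y: "Y = mat2 (1 + a) b c (1 + d)"
    and v: "vabs a < 1" "vabs b \<le> 1" "vabs c < 1" "vabs d < 1"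
    by (auto simp: I1_def max_ideal_def integer_ring_def)
  have 1: "vabs (1 + a) = 1" "vabs (1 + d) = 1"
    using v vabs_add_eq_left[of a 1] vabs_add_eq_left[of d 1] by auto
  have "vabs (- (c * b)) < 1"
    using v vabs_mult_le[of c _ b, OF order_refl] by (auto intro: le_less_trans)
  then have "vabs (det Y) = 1"
    using 1 vabs_add_eq_left[of "- (c * b)" "(1 + a) * (1 + d)"]
    by (simp add: Y det_2 vabs_mult mult.commute)
  then show "Y \<in> iwahori"
    using v 1 by (auto simp: iwahori_def Y forall_2)
qed

text \<open>A unit of E has unit norm, which forces integral coordinates in the basis 1,
  \<open>pi_E \<pi>\<close>; the lower left entry carries a factor \<pi>.\<close>

lemma E_integer_units_subset_iwahori:
  assumes \<pi>: "uniformizer (\<pi>::'a::padic_field)"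
  shows "E_integer_units \<pi> \<subseteq> iwahori"
proof
  fix x
  assume "x \<in> E_integer_units \<pi>"
  then obtain a b y where x: "x = mat a + mat b ** pi_E \<pi>"
    and "E_abs x \<le> 1" "E_abs y \<le> 1" and xy: "x ** y = mat 1"
    by (auto simp: E_integer_units_def E_integers_def E_field_def)
  then have le: "vabs (det x) \<le> 1" "vabs (det y) \<le> 1"
    by (simp_all add: E_abs_def)
  have "vabs (det x) * vabs (det y) = 1"
    using xy by (metis det_I det_mul vabs_1 vabs_mult)
  with le have det: "vabs (det x) = 1"
    by (metis mult_left_le order_antisym vabs_nonneg)
  have nth: "x $ 1 $ 1 = a" "x $ 1 $ 2 = b" "x $ 2 $ 1 = b * \<pi>" "x $ 2 $ 2 = a"
    by (simp_all add: x pi_E_def matrix_mult_nth_2 mat_def)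
  have "det x = a\<^sup>2 - b\<^sup>2 * \<pi>"
    by (simp add: det_2 nth power2_eq_square)
  with le have "vabs (a\<^sup>2 - b\<^sup>2 * \<pi>) \<le> 1"
    by simp
  note ab = uniformizer_norm_integral[OF \<pi> this]
  have "vabs (\<pi> * b) \<le> vabs \<pi>"
    using ab by (intro vabs_mult_le) auto
  then have "vabs (b * \<pi>) < 1"
    using uniformizer_vabs(2)[OF \<pi>] by (simp add: mult.commute)
  then show "x \<in> iwahori"
    using ab det by (auto simp: iwahori_def nth forall_2)
qed

lemma C0_subset_iwahori:
  assumes "uniformizer \<pi>" "L \<subseteq> I1"
  shows "C0 \<pi> L \<subseteq> iwahori"
  using E_integer_units_subset_iwahori[OF assms(1)] I1_subset_iwahori assms(2)
  by (auto simp: C0_def set_mult_def GL2_def intro!: iwahori_mult)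

lemma integral_asym_iwahori: "Y \<in> iwahori \<Longrightarrow> integral_asym Y"
  by (auto simp: iwahori_def integral_asym_def asym_form_def power2_eq_square vabs_2_le
      intro!: vabs_diff_le vabs_add_le vabs_mult_le)

lemma integral_asym_pi_E_iwahori:
  assumes \<pi>: "uniformizer (\<pi>::'a::padic_field)" and Y: "Y \<in> iwahori"
  shows "integral_asym (pi_E \<pi> ** Y)"
proof -
  note p = uniformizer_vabs[OF \<pi>]
  have int: "vabs (Y $ i $ j) \<le> 1" for i j
    using Y by (simp add: iwahori_def)
  have c: "vabs (Y $ 2 $ 1) \<le> vabs \<pi>"
    using Y p(3) by (simp add: iwahori_def)
  \<comment> \<open>Multiplication by \<open>pi_E \<pi>\<close> swaps the rows and scales the new
    lower one by \<pi>. Each product is grouped with a factor divisible by \<pi> in front, as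
    \<open>vabs_mult_le\<close> requires.\<close>
  have "asym_form (pi_E \<pi> ** Y)
      = Y $ 2 $ 1 * Y $ 2 $ 1 + \<pi> * (\<pi> * (Y $ 1 $ 2 * Y $ 1 $ 2)) - \<pi> * (2 * (Y $ 2 $ 2 * Y $ 1 $ 1))"
    by (simp add: asym_form_def pi_E_def matrix_mult_nth_2 power2_eq_square)
  also have "vabs \<dots> \<le> vabs \<pi>"
    using c int p(2) vabs_2_le by (intro vabs_diff_le vabs_add_le vabs_mult_le) auto
  also have "vabs \<pi> = vabs (det (pi_E \<pi> ** Y))"
    using Y by (simp add: det_mul vabs_mult iwahori_def pi_E_def det_2[of "mat2 _ _ _ _"])
  finally show ?thesis
    by (simp add: integral_asym_def)
qed

section \<open>The inverse of S(\<gamma>) and the conclusion\<close>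

lemma matrix_inv_eqI:
  fixes A :: "'a::semiring_1^'n^'m"
  assumes "A ** B = mat 1" "B ** A = mat 1"
  shows "matrix_inv A = B"
  unfolding matrix_inv_def
\<comment> \<open>\<open>matrix_inv\<close> is a choice operator, so uniqueness of the two-sided
  inverse is also required.\<close>
proof (rule some_equality)
  show "A ** B = mat 1 \<and> B ** A = mat 1"
    using assms by simp
  show "B' = B" if "A ** B' = mat 1 \<and> B' ** A = mat 1" for B'
    using that assms by (metis matrix_mul_assoc matrix_mul_lid matrix_mul_rid)
qed

text \<open>Since \<open>inverse \<alpha> - 1 = - (\<alpha> - 1) / \<alpha>\<close>, both diagonal
  entries of the inverse share the factor \<open>inverse (\<alpha> - 1)\<close>.\<close>

lemma matrix_inv_S_map_diag:
  fixes \<alpha> :: "'a::padic_field"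
  assumes "\<alpha> \<noteq> 0" "\<alpha> \<noteq> 1"
  shows "matrix_inv (S_map (mat2 \<alpha> 0 0 (inverse \<alpha>)))
    = mat2 (inverse (\<alpha> - 1)) 0 0 (- \<alpha> * inverse (\<alpha> - 1))"
  using assms
  by (intro matrix_inv_eqI)
    (simp_all add: vec_eq_iff forall_2 matrix_mult_nth_2 S_map_def mat_def field_simps)

lemma not_integral_asym_S_map_inv:
  fixes \<alpha> :: "'a::padic_field"
  assumes "\<alpha> \<noteq> 0" "\<alpha> \<noteq> 1" "\<alpha> \<notin> integer_units"
  shows "\<not> integral_asym (matrix_inv (S_map (mat2 \<alpha> 0 0 (inverse \<alpha>))))"
proof
  define x where "x = inverse (\<alpha> - 1)"
  assume "integral_asym (matrix_inv (S_map (mat2 \<alpha> 0 0 (inverse \<alpha>))))"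
  then have "vabs (x\<^sup>2 * (1 + \<alpha>\<^sup>2)) \<le> vabs (x\<^sup>2 * (- \<alpha>))"
    using assms(1,2)
    by (simp add: matrix_inv_S_map_diag integral_asym_def asym_form_def det_2 algebra_simps
        power2_eq_square flip: x_def)
  moreover have "vabs (x\<^sup>2) > 0"
    using assms(2) by (simp add: x_def less_le)
  \<comment> \<open>This fails off the units: one of the two summands on the left dominates, so the
    left side is the larger of 1 and \<open>(vabs \<alpha>)\<^sup>2\<close>, which exceeds
    \<open>vabs \<alpha>\<close>.\<close>
  ultimately have le: "vabs (1 + \<alpha>\<^sup>2) \<le> vabs \<alpha>"
    by (simp add: vabs_mult)
  consider "vabs \<alpha> < 1" | "vabs \<alpha> > 1"
    using assms(3) by (fastforce simp: integer_units_iff)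
  then show False
  proof cases
    case 1
    then have "vabs (\<alpha>\<^sup>2) < 1"
      by (simp add: vabs_power abs_square_less_1)
    with 1 le vabs_add_eq_left[of "\<alpha>\<^sup>2" 1] show False by simp
  next
    case 2
    then have "vabs (\<alpha>\<^sup>2) > vabs \<alpha>"
      by (simp add: vabs_mult power2_eq_square)
    with 2 le vabs_add_eq_left[of 1 "\<alpha>\<^sup>2"] show False by (simp add: add.commute)
  qed
qed

theorem proposition20:
  fixes \<pi> \<alpha> :: "'a::padic_field"
    and L :: "('a^2^2) set"
  assumes "uniformizer \<pi>"
    and "subgroup L GL2"
    and "compact L"
    and "openin (top_of_set (carrier GL2)) L"
    and "L \<subseteq> I1"
    and "subgroup (G_prime \<pi> L) GL2"
    and "\<alpha> \<noteq> 0" and "\<alpha> \<noteq> 1" and "\<alpha> \<noteq> - 1"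
    and "\<alpha> \<notin> integer_units"
  shows "\<forall>Y \<in> C_set \<pi> L.
           \<not> eps_conjugate (matrix_inv (S_map (mat2 \<alpha> 0 0 (inverse \<alpha>)))) Y"
proof
  fix Y
  assume "Y \<in> C_set \<pi> L"
  then have "integral_asym Y"
    using C0_subset_iwahori[OF assms(1,5)] integral_asym_iwahori
      integral_asym_pi_E_iwahori[OF assms(1)]
    by (auto simp: C_set_def l_coset_def GL2_def)
  then show "\<not> eps_conjugate (matrix_inv (S_map (mat2 \<alpha> 0 0 (inverse \<alpha>)))) Y"
    using integral_asym_eps_conjugate not_integral_asym_S_map_inv[OF assms(7,8,10)] by blast
qed

end
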